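(* Let $N\ge 1$ be a fixed integer and let $x_0,\dots,x_N\in[0,L]$ be fixed points, with $x_1,\dots,x_{N-1}\in(0,L)$. Let $u:[0,L]\to\mathbb{R}$ be four times differentiable with continuous derivatives, and suppose $u''(x_i)=1$ for every $i$, $u(x_0)=0$ and $u(x_N)=0$. For a discretization step $h$, let $A_h$ be the $(N+1)\times(N+1)$ matrix equal to $\frac1{h^2}$ times the matrix whose first row is $(1,0,\dots,0)$, whose last row is $(0,\dots,0,1)$, and whose row $i$, for $1\le i\le N-1$, has entries $1,-2,1$ in columns $i-1,i,i+1$ and zeros elsewhere (rows and columns indexed by $0,\dots,N$). Let $r_hu=(u_0,u_1,\dots,u_N)^T$ and $s_hAu=(0,1,\dots,1,0)^T\in\mathbb{R}^{N+1}$, where in row $i$ of the product $A_hr_hu$ one reads $u_i=u(x_i)$, $u_{i-1}=u(x_i-h)$ and $u_{i+1}=u(x_i+h)$. Then the scheme is consistent at $u$: $$\lim_{h\to0}\|A_hr_hu-s_hAu\|_1=\lim_{h\to0}\Big[\Big|\frac{u_0}{h^2}\Big|+\sum_{i=1}^{N-1}\Big|\frac{u_{i-1}-2u_i+u_{i+1}}{h^2}-1\Big|+\Big|\frac{u_N}{h^2}\Big|\Big]=0.$$ In particular, $$\lim_{h\to0}\sum_{i=1}^{N-1}\Big|\frac{u(x_i-h)-2u(x_i)+u(x_i+h)}{h^2}-1\Big|=\sum_{i=1}^{N-1}\lim_{h\to0}\Big|\frac{u(x_i-h)-2u(x_i)+u(x_i+h)}{h^2}-1\Big|=0.$$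
   Context: The differential equation is $u''=1$ on $(0,L)$ with $u(0)=u(L)=0$, where $L>0$ is the length of the domain, and $A$ is the operator $d^2/dx^2$ of this problem. The scheme replaces $u''(x)$ by $(u(x+h)-2u(x)+u(x-h))/h^2$. The vector $r_hu$ is the restriction of $u$ to the discrete domain and $s_hAu$ is the discretized right-hand side. The norm is $\|v\|_1=\sum_{i=0}^N|v_i|$. In the limit, $N$ and the points $x_i$ are fixed parameters and only $h$ tends to $0$. *)

theory Defs
  imports "HOL-Analysis.Derivative" "Jordan_Normal_Form.Matrix"
begin

text \<open>Derivatives are taken within a set \<open>S\<close>, so that on \<open>S = {0..L}\<close> they are one-sided at
  the two endpoints and depend only on the values of the function on \<open>S\<close>.\<close>

primrec nth_deriv_within :: "real set \<Rightarrow> nat \<Rightarrow> (real \<Rightarrow> real) \<Rightarrow> real \<Rightarrow> real" where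
  "nth_deriv_within S 0 f = f"
| "nth_deriv_within S (Suc n) f =
     (\<lambda>t. vector_derivative (nth_deriv_within S n f) (at t within S))"

definition C_n_on :: "nat \<Rightarrow> real set \<Rightarrow> (real \<Rightarrow> real) \<Rightarrow> bool" where
  "C_n_on n S f \<longleftrightarrow>
     (\<forall>k<n. nth_deriv_within S k f differentiable_on S) \<and>
     (\<forall>k\<le>n. continuous_on S (nth_deriv_within S k f))"

definition scheme_matrix :: "nat \<Rightarrow> real \<Rightarrow> real mat" where
  "scheme_matrix N h = (1 / h\<^sup>2) \<cdot>\<^sub>m mat (N + 1) (N + 1) (\<lambda>(i, j).
     if i = 0 \<or> i = N then (if j = i then 1 else 0)
     else if j = i then - 2
     else if j + 1 = i \<or> j = i + 1 then 1
     else 0)"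

text \<open>The restriction \<open>r\<^sub>h u = (u\<^sub>0, \<dots>, u\<^sub>N)\<close> as it is read in row \<open>i\<close> of the product
  \<open>A\<^sub>h r\<^sub>h u\<close>: there \<open>u\<^sub>i\<close>, \<open>u\<^sub>i\<^sub>-\<^sub>1\<close>, \<open>u\<^sub>i\<^sub>+\<^sub>1\<close> denote the values of \<open>u\<close> at \<open>x\<^sub>i\<close>, \<open>x\<^sub>i - h\<close>, \<open>x\<^sub>i + h\<close>,
  since the points \<open>x\<^sub>i\<close> stay fixed while \<open>h\<close> varies. The entries that meet a zero of row \<open>i\<close>
  do not affect the product; this includes the neighbours in rows \<open>0\<close> and \<open>N\<close>,
  where \<open>x\<^sub>i \<plusminus> h\<close> may lie outside \<open>[0, L]\<close>.\<close>

definition restriction_in_row :: "nat \<Rightarrow> (nat \<Rightarrow> real) \<Rightarrow> (real \<Rightarrow> real) \<Rightarrow> real \<Rightarrow> nat \<Rightarrow> real vec" where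
  "restriction_in_row N x u h i = vec (N + 1) (\<lambda>j.
     if j + 1 = i then u (x i - h)
     else if j = i + 1 then u (x i + h)
     else u (x j))"

definition scheme_product :: "nat \<Rightarrow> (nat \<Rightarrow> real) \<Rightarrow> (real \<Rightarrow> real) \<Rightarrow> real \<Rightarrow> real vec" where
  "scheme_product N x u h = vec (N + 1) (\<lambda>i.
     scalar_prod (row (scheme_matrix N h) i) (restriction_in_row N x u h i))"

definition discrete_rhs :: "nat \<Rightarrow> real vec" where
  "discrete_rhs N = vec (N + 1) (\<lambda>i. if i = 0 \<or> i = N then 0 else 1)"

definition l1_norm_vec :: "real vec \<Rightarrow> real" where
  "l1_norm_vec v = (\<Sum>i<dim_vec v. \<bar>vec_index v i\<bar>)"

definition scheme_consistent_at :: "nat \<Rightarrow> (nat \<Rightarrow> real) \<Rightarrow> (real \<Rightarrow> real) \<Rightarrow> bool" where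
  "scheme_consistent_at N x u \<longleftrightarrow>
     ((\<lambda>h. l1_norm_vec (scheme_product N x u h - discrete_rhs N)) \<longlongrightarrow> 0) (at 0)"

end

theory Submission
  imports Defs
begin

text \<open>Every row of the scheme is either a boundary row or a symmetric second difference.
  The boundary rows contribute \<open>u(x\<^sub>0)/h\<^sup>2\<close> and \<open>u(x\<^sub>N)/h\<^sup>2\<close>, which vanish for every \<open>h\<close> because
  \<open>u\<close> satisfies the boundary conditions exactly (\<open>l1_norm_scheme_residual\<close>). An interior row
  contributes the residual of \<open>(u(x\<^sub>i-h) - 2u(x\<^sub>i) + u(x\<^sub>i+h))/h\<^sup>2\<close>, which tends to \<open>u''(x\<^sub>i) = 1\<close>
  by one application of l'Hopital's rule: the quotient of the derivatives in \<open>h\<close> is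
  \<open>(u'(x\<^sub>i+h) - u'(x\<^sub>i-h))/(2h)\<close>, the symmetric difference quotient of \<open>u'\<close>
  (\<open>symmetric_second_difference_tendsto\<close>). Since the points are interior, \<open>x\<^sub>i \<plusminus> h\<close> stays in
  \<open>[0,L]\<close> for small \<open>h\<close>, and the one-sided derivatives are ordinary ones. As \<open>N\<close> is fixed,
  the limit of the sum is the sum of the limits.\<close>

section \<open>Second differences\<close>

lemma symmetric_difference_quotient_tendsto:
  fixes g :: "real \<Rightarrow> real"
  assumes "(g has_real_derivative c) (at a)"
  shows "((\<lambda>h. (g (a + h) - g (a - h)) / (2 * h)) \<longlongrightarrow> c) (at 0)"
proof -
  have right: "((\<lambda>h. (g (a + h) - g a) / h) \<longlongrightarrow> c) (at 0)"
    using assms by (simp add: DERIV_def)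
  have "filterlim (uminus :: real \<Rightarrow> real) (at 0) (at 0)"
    using filtermap_at_minus[of "0 :: real"] by (simp add: filterlim_def)
  from filterlim_compose[OF right this]
  have left: "((\<lambda>h. (g (a + - h) - g a) / - h) \<longlongrightarrow> c) (at 0)" .
  have "((\<lambda>h. ((g (a + h) - g a) / h + (g (a + - h) - g a) / - h) / 2) \<longlongrightarrow> (c + c) / 2) (at 0)"
    by (intro tendsto_intros right left) simp
  moreover have "((g (a + h) - g a) / h + (g (a + - h) - g a) / - h) / 2
      = (g (a + h) - g (a - h)) / (2 * h)" for h
    by (cases "h = 0") (simp_all add: field_simps)
  moreover have "(c + c) / 2 = c" by simp
  ultimately show ?thesis by (simp only:)
qed

text \<open>Only one application of l'Hopital's rule is possible: \<open>f'\<close> is assumed differentiable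
  at the single point \<open>a\<close>, so the remaining quotient is read as a difference quotient of \<open>f'\<close>.\<close>

lemma symmetric_second_difference_tendsto:
  fixes f f' :: "real \<Rightarrow> real"
  assumes f: "eventually (\<lambda>t. (f has_real_derivative f' t) (at t)) (nhds a)"
    and f': "(f' has_real_derivative c) (at a)"
  shows "((\<lambda>h. (f (a - h) - 2 * f a + f (a + h)) / h\<^sup>2) \<longlongrightarrow> c) (at 0)"
proof (rule lhopital)
  have plus: "((\<lambda>h. a + h) \<longlongrightarrow> a) (at 0)" and minus: "((\<lambda>h. a - h) \<longlongrightarrow> a) (at 0)"
    by (auto intro!: tendsto_eq_intros)
  have cont: "isCont f a"
    using eventually_nhds_x_imp_x[OF f] by (rule DERIV_isCont)
  have "((\<lambda>h. f (a - h) - 2 * f a + f (a + h)) \<longlongrightarrow> f a - 2 * f a + f a) (at 0)"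
    by (intro tendsto_intros isCont_tendsto_compose[OF cont] plus minus)
  then show "((\<lambda>h. f (a - h) - 2 * f a + f (a + h)) \<longlongrightarrow> 0) (at 0)" by simp
  show "((\<lambda>h::real. h\<^sup>2) \<longlongrightarrow> 0) (at 0)"
    by (auto intro!: tendsto_eq_intros)
  show "eventually (\<lambda>h::real. h\<^sup>2 \<noteq> 0) (at 0)"
    and "eventually (\<lambda>h::real. 2 * h \<noteq> 0) (at 0)"
    by (auto simp: eventually_at_filter)
  show "eventually (\<lambda>h::real. ((\<lambda>h. h\<^sup>2) has_real_derivative 2 * h) (at h)) (at 0)"
    by (rule always_eventually) (auto intro!: derivative_eq_intros)
  show "eventually (\<lambda>h. ((\<lambda>h. f (a - h) - 2 * f a + f (a + h)) has_real_derivative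
      f' (a + h) - f' (a - h)) (at h)) (at 0)"
    using eventually_compose_filterlim[OF f plus] eventually_compose_filterlim[OF f minus]
  proof eventually_elim
    case (elim h)
    have "((\<lambda>h. f (a + h)) has_real_derivative f' (a + h) * 1) (at h)"
      by (rule DERIV_chain2[where f = f and g = "\<lambda>h. a + h", OF elim(1)]) (auto intro!: derivative_eq_intros)
    moreover have "((\<lambda>h. f (a - h)) has_real_derivative f' (a - h) * (- 1)) (at h)"
      by (rule DERIV_chain2[where f = f and g = "\<lambda>h. a - h", OF elim(2)]) (auto intro!: derivative_eq_intros)
    ultimately show ?case
      by (auto intro!: derivative_eq_intros)
  qed
  show "((\<lambda>h. (f' (a + h) - f' (a - h)) / (2 * h)) \<longlongrightarrow> c) (at 0)"
    by (rule symmetric_difference_quotient_tendsto[OF f'])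
qed

lemma nth_deriv_within_has_real_derivative:
  assumes "C_n_on n S f" "k < n" "t \<in> interior S"
  shows "(nth_deriv_within S k f has_real_derivative nth_deriv_within S (Suc k) f t) (at t)"
proof -
  have "nth_deriv_within S k f differentiable (at t within S)"
    using assms(1,2) interior_subset[THEN subsetD, OF assms(3)]
    unfolding C_n_on_def differentiable_on_def by blast
  then have "(nth_deriv_within S k f has_vector_derivative nth_deriv_within S (Suc k) f t)
      (at t within S)"
    by (simp only: nth_deriv_within.simps vector_derivative_works)
  then show ?thesis
    by (simp only: at_within_interior[OF assms(3)] has_real_derivative_iff_has_vector_derivative)
qed

lemma C_n_on_second_difference_tendsto:
  assumes "C_n_on n S f" "2 \<le> n" "a \<in> interior S"
  shows "((\<lambda>h. (f (a - h) - 2 * f a + f (a + h)) / h\<^sup>2) \<longlongrightarrow> nth_deriv_within S 2 f a) (at 0)"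
proof (rule symmetric_second_difference_tendsto)
  have "eventually (\<lambda>t. t \<in> interior S) (nhds a)"
    using assms(3) by (intro eventually_nhds_in_open) auto
  then show "eventually (\<lambda>t. (f has_real_derivative nth_deriv_within S 1 f t) (at t)) (nhds a)"
    by eventually_elim
      (use nth_deriv_within_has_real_derivative[OF assms(1), of 0] assms(2) in simp)
  show "(nth_deriv_within S 1 f has_real_derivative nth_deriv_within S 2 f a) (at a)"
    using nth_deriv_within_has_real_derivative[OF assms(1), of 1 a] assms(2,3)
    by (simp add: numeral_2_eq_2)
qed

section \<open>Rows of the scheme\<close>

lemma scheme_product_index:
  assumes "i \<le> N"
  shows "vec_index (scheme_product N x u h) i =
    (\<Sum>j<N + 1. 1 / h\<^sup>2 *
      (if i = 0 \<or> i = N then (if j = i then 1 else 0)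
       else if j = i then - 2
       else if j + 1 = i \<or> j = i + 1 then 1 else 0) *
      (if j + 1 = i then u (x i - h) else if j = i + 1 then u (x i + h) else u (x j)))"
  using assms
  by (auto simp: scheme_product_def scheme_matrix_def restriction_in_row_def scalar_prod_def
      atLeast0LessThan intro!: sum.cong)

lemma scheme_product_boundary:
  assumes "i = 0 \<or> i = N"
  shows "vec_index (scheme_product N x u h) i = u (x i) / h\<^sup>2"
proof -
  have "i \<le> N" using assms by auto
  have "vec_index (scheme_product N x u h) i
      = (\<Sum>j<N + 1. if j = i then u (x i) / h\<^sup>2 else 0)"
    unfolding scheme_product_index[OF \<open>i \<le> N\<close>] using assms by (intro sum.cong) auto
  then show ?thesis using \<open>i \<le> N\<close> by simp
qed

lemma scheme_product_interior:
  assumes "0 < i" "i < N"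
  shows "vec_index (scheme_product N x u h) i = (u (x i - h) - 2 * u (x i) + u (x i + h)) / h\<^sup>2"
proof -
  obtain k where k: "i = Suc k" using assms(1) by (cases i) auto
  have "vec_index (scheme_product N x u h) i =
    (\<Sum>j\<in>{k, Suc k, Suc (Suc k)}. 1 / h\<^sup>2 *
      (if j = i then - 2 else 1) *
      (if j + 1 = i then u (x i - h) else if j = i + 1 then u (x i + h) else u (x j)))"
    unfolding scheme_product_index[OF less_imp_le[OF assms(2)]]
    using assms k by (intro sum.mono_neutral_cong_right) auto
  then show ?thesis using k by (simp add: add_divide_distrib diff_divide_distrib)
qed

lemma l1_norm_scheme_residual:
  assumes "1 \<le> N"
  shows "l1_norm_vec (scheme_product N x u h - discrete_rhs N) =
    \<bar>u (x 0) / h\<^sup>2\<bar>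
    + (\<Sum>i = 1..N - 1. \<bar>(u (x i - h) - 2 * u (x i) + u (x i + h)) / h\<^sup>2 - 1\<bar>)
    + \<bar>u (x N) / h\<^sup>2\<bar>"
proof -
  let ?r = "\<lambda>i. \<bar>vec_index (scheme_product N x u h - discrete_rhs N) i\<bar>"
  have split: "{..<N + 1} = insert 0 (insert N {1..N - 1})"
    using assms by auto
  have "l1_norm_vec (scheme_product N x u h - discrete_rhs N) = sum ?r {..<N + 1}"
    by (simp add: l1_norm_vec_def discrete_rhs_def)
  also have "\<dots> = ?r 0 + ?r N + sum ?r {1..N - 1}"
    unfolding split using assms by (simp add: add.assoc)
  also have "?r 0 = \<bar>u (x 0) / h\<^sup>2\<bar>"
    by (simp add: discrete_rhs_def scheme_product_boundary)
  also have "?r N = \<bar>u (x N) / h\<^sup>2\<bar>"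
    by (simp add: discrete_rhs_def scheme_product_boundary)
  also have "sum ?r {1..N - 1} =
      (\<Sum>i = 1..N - 1. \<bar>(u (x i - h) - 2 * u (x i) + u (x i + h)) / h\<^sup>2 - 1\<bar>)"
    by (intro sum.cong refl) (auto simp: discrete_rhs_def scheme_product_interior)
  finally show ?thesis by simp
qed

section \<open>Consistency\<close>

theorem mainTheorem3:
  fixes L :: real and N :: nat and x :: "nat \<Rightarrow> real" and u :: "real \<Rightarrow> real"
  assumes "L > 0"
    and "N \<ge> 1"
    and "\<forall>i\<le>N. x i \<in> {0..L}"
    and "\<forall>i\<in>{1..N - 1}. x i \<in> {0<..<L}"
    and "C_n_on 4 {0..L} u"
    and "\<forall>i\<le>N. nth_deriv_within {0..L} 2 u (x i) = 1"
    and "u (x 0) = 0"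
    and "u (x N) = 0"
  shows "scheme_consistent_at N x u
    \<and> ((\<lambda>h. \<bar>u (x 0) / h\<^sup>2\<bar>
          + (\<Sum>i = 1..N - 1. \<bar>(u (x i - h) - 2 * u (x i) + u (x i + h)) / h\<^sup>2 - 1\<bar>)
          + \<bar>u (x N) / h\<^sup>2\<bar>) \<longlongrightarrow> 0) (at 0)
    \<and> (\<forall>i\<in>{1..N - 1}. \<exists>l.
          ((\<lambda>h. \<bar>(u (x i - h) - 2 * u (x i) + u (x i + h)) / h\<^sup>2 - 1\<bar>) \<longlongrightarrow> l) (at 0))
    \<and> ((\<lambda>h. \<Sum>i = 1..N - 1. \<bar>(u (x i - h) - 2 * u (x i) + u (x i + h)) / h\<^sup>2 - 1\<bar>) \<longlongrightarrow>
          (\<Sum>i = 1..N - 1.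
             Lim (at 0) (\<lambda>h. \<bar>(u (x i - h) - 2 * u (x i) + u (x i + h)) / h\<^sup>2 - 1\<bar>))) (at 0)
    \<and> (\<Sum>i = 1..N - 1.
          Lim (at 0) (\<lambda>h. \<bar>(u (x i - h) - 2 * u (x i) + u (x i + h)) / h\<^sup>2 - 1\<bar>)) = 0"
proof -
  let ?e = "\<lambda>i h. \<bar>(u (x i - h) - 2 * u (x i) + u (x i + h)) / h\<^sup>2 - 1\<bar>"
  have e: "(?e i \<longlongrightarrow> 0) (at 0)" if i: "i \<in> {1..N - 1}" for i
  proof -
    have "x i \<in> interior {0..L}" using assms(4) i by simp
    then have second_difference: "((\<lambda>h. (u (x i - h) - 2 * u (x i) + u (x i + h)) / h\<^sup>2)
        \<longlongrightarrow> nth_deriv_within {0..L} 2 u (x i)) (at 0)"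
      by (intro C_n_on_second_difference_tendsto[OF assms(5)]) simp_all
    have "((\<lambda>h. (u (x i - h) - 2 * u (x i) + u (x i + h)) / h\<^sup>2) \<longlongrightarrow> 1) (at 0)"
    proof -
      have "i \<le> N" using i by auto
      then have "nth_deriv_within {0..L} 2 u (x i) = 1" using assms(6) by blast
      with second_difference show ?thesis by simp
    qed
    then show ?thesis
      by (intro tendsto_rabs_zero) (simp add: LIM_zero)
  qed
  then have lim: "Lim (at 0) (?e i) = 0" if "i \<in> {1..N - 1}" for i
    using that by (intro tendsto_Lim) auto
  have sum: "((\<lambda>h. \<Sum>i = 1..N - 1. ?e i h) \<longlongrightarrow> 0) (at 0)"
    using tendsto_sum[of "{1..N - 1}" ?e "\<lambda>_. 0"] e by simp
  then have total: "((\<lambda>h. \<bar>u (x 0) / h\<^sup>2\<bar> + (\<Sum>i = 1..N - 1. ?e i h) + \<bar>u (x N) / h\<^sup>2\<bar>)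
      \<longlongrightarrow> 0) (at 0)"
    using assms(7,8) by simp
  then have "scheme_consistent_at N x u"
    by (simp only: scheme_consistent_at_def l1_norm_scheme_residual[OF assms(2)])
  moreover have "(\<Sum>i = 1..N - 1. Lim (at 0) (?e i)) = 0"
    by (intro sum.neutral ballI lim)
  ultimately show ?thesis
    using total e sum by (intro conjI ballI) (auto simp only:)
qed

end
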